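(* Let $D$ be an integral domain that is not a field. If $D[X]$ is a Clifford $w$-regular domain, then $D$ is a Clifford $w$-regular domain. If $D[X]$ is a $w$-stable domain, then $D$ is a $w$-stable domain.
   Context: For an integral domain $D$ with field of fractions $K$, "ideal" means fractional ideal, an integral ideal is an ideal contained in $D$, and $\mathcal{F}(D)$ is the set of nonzero ideals. For ideals $I,J$, $(J:I)=\{x\in K: xI\subseteq J\}$. For $I\in\mathcal F(D)$: $I^v=(D:(D:I))$; $I^t=\bigcup\{J^v: J\in\mathcal F(D)\text{ finitely generated}, J\subseteq I\}$; $I$ is a $t$-ideal if $I=I^t$; a $t$-maximal ideal is an ideal maximal among the proper integral $t$-ideals (it is prime), and $t\text{-Max}(D)$ is the set of these; $I^w=\bigcap_{M\in t\text{-Max}(D)}ID_M$, equivalently $I^w=\bigcup\{(I:J): J\text{ finitely generated},(D:J)=D\}$. These are defined for every domain (e.g. $D[X]$, $X$ an indeterminate, with its own $w$-operation). $I$ is $w$-stable if, with $E=(I^w:I^w)$, $(I^w(E:I^w))^w=E$ ($w$ being the $w$-operation of $D$); $D$ is $w$-stable if every nonzero ideal is $w$-stable. $I$ is $w$-regular if $I^w=(I^2J)^w$ for some nonzero ideal $J$; $D$ is Clifford $w$-regular if every nonzero ideal is $w$-regular. *)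

theory Defs
  imports Main "HOL-Computational_Algebra.Polynomial_Factorial"
begin

text \<open>
  A domain \<open>D\<close> is a type \<open>'a :: idom\<close>, its field of fractions \<open>K\<close> is \<open>'a fract\<close>, and
  \<open>D\<close> sits inside \<open>K\<close> as the range of \<^const>\<open>to_fract\<close>. Ideals are subsets of \<open>K\<close>.
  Since \<open>'a poly\<close> is again an \<open>idom\<close>, every notion below applies to \<open>D[X]\<close> as well.
\<close>

definition base_ring :: "'a::idom fract set" where
  "base_ring = range to_fract"

global_interpretation fract_mod: module "\<lambda>(d::'a::idom) x. to_fract d * x"
  by unfold_locales (simp_all add: algebra_simps)

definition nonzero_ideals :: "'a::idom fract set set" where
  "nonzero_ideals = {I. fract_mod.subspace I \<and> I \<noteq> {0} \<and>
     (\<exists>d::'a. d \<noteq> 0 \<and> (\<forall>x\<in>I. to_fract d * x \<in> base_ring))}"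

definition ideal_fg :: "'a::idom fract set \<Rightarrow> bool" where
  "ideal_fg J \<longleftrightarrow> (\<exists>S. finite S \<and> J = fract_mod.span S)"

text \<open>Also used below for the product of an ideal with an overring of \<open>D\<close>.\<close>

definition ideal_prod :: "'a::idom fract set \<Rightarrow> 'a fract set \<Rightarrow> 'a fract set" where
  "ideal_prod I J = fract_mod.span {x * y | x y. x \<in> I \<and> y \<in> J}"

text \<open>\<open>colon J I\<close> is \<open>(J : I)\<close>, computed in \<open>K\<close>.\<close>

definition colon :: "'a::idom fract set \<Rightarrow> 'a fract set \<Rightarrow> 'a fract set" where
  "colon J I = {x. \<forall>y\<in>I. x * y \<in> J}"

definition v_op :: "'a::idom fract set \<Rightarrow> 'a fract set" where
  "v_op I = colon base_ring (colon base_ring I)"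

definition t_op :: "'a::idom fract set \<Rightarrow> 'a fract set" where
  "t_op I = \<Union> {v_op J | J. J \<in> nonzero_ideals \<and> ideal_fg J \<and> J \<subseteq> I}"

definition proper_t_ideals :: "'a::idom fract set set" where
  "proper_t_ideals = {I \<in> nonzero_ideals. I \<subset> base_ring \<and> t_op I = I}"

definition t_Max :: "'a::idom fract set set" where
  "t_Max = {M \<in> proper_t_ideals. \<forall>N\<in>proper_t_ideals. M \<subseteq> N \<longrightarrow> N = M}"

definition localization_at :: "'a::idom fract set \<Rightarrow> 'a fract set" where
  "localization_at M = {a / s | a s. a \<in> base_ring \<and> s \<in> base_ring - M}"

definition w_op :: "'a::idom fract set \<Rightarrow> 'a fract set" where
  "w_op I = (\<Inter>M\<in>t_Max. ideal_prod I (localization_at M))"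

definition w_stable :: "'a::idom fract set \<Rightarrow> bool" where
  "w_stable I \<longleftrightarrow>
     (let E = colon (w_op I) (w_op I)
      in w_op (ideal_prod (w_op I) (colon E (w_op I))) = E)"

definition w_regular :: "'a::idom fract set \<Rightarrow> bool" where
  "w_regular I \<longleftrightarrow>
     (\<exists>J\<in>nonzero_ideals. w_op I = w_op (ideal_prod (ideal_prod I I) J))"

definition w_stable_domain :: "'a::idom itself \<Rightarrow> bool" where
  "w_stable_domain (_ :: 'a itself) \<longleftrightarrow>
     (\<forall>I\<in>(nonzero_ideals :: 'a fract set set). w_stable I)"

definition clifford_w_regular_domain :: "'a::idom itself \<Rightarrow> bool" where
  "clifford_w_regular_domain (_ :: 'a itself) \<longleftrightarrow>
     (\<forall>I\<in>(nonzero_ideals :: 'a fract set set). w_regular I)"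

end

theory Submission
  imports Defs
begin

text \<open>
  The \<open>w\<close>-operation is detected by Glaz--Vasconcelos ideals: \<open>x\<close> lies in \<open>I\<^sup>w\<close> iff \<open>S x\<close> is
  contained in \<open>I\<close> for some finite set \<open>S\<close> of elements of \<open>D\<close> with \<open>(D : S) = D\<close>. The coefficients
  of such a set in \<open>D[X]\<close> form such a set in \<open>D\<close>, so a McCoy-type argument gives
  \<open>I[X]\<^sup>w = I\<^sup>w[X]\<close>. As \<open>I \<mapsto> I[X]\<close> is injective and also commutes with products and colons,
  \<open>I\<close> is \<open>w\<close>-stable iff \<open>I[X]\<close> is. For regularity, the second factor \<open>J\<close> in \<open>(I\<^sup>2J)\<^sup>w\<close> can always
  be taken to be the largest possible one, \<open>(I\<^sup>w : I\<^sup>2)\<close>, which is compatible with extension.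
\<close>

subsection \<open>Fractional ideals\<close>

lemma in_base_ring [simp]: "to_fract a \<in> base_ring"
  by (simp add: base_ring_def)

lemma base_ringE:
  assumes "x \<in> base_ring"
  obtains a where "x = to_fract a"
  using assms by (auto simp: base_ring_def)

lemma zero_in_base_ring [simp]: "0 \<in> base_ring"
  by (metis in_base_ring to_fract_0)

lemma one_in_base_ring [simp]: "1 \<in> base_ring"
  by (metis in_base_ring to_fract_1)

lemma base_ring_add: "x \<in> base_ring \<Longrightarrow> y \<in> base_ring \<Longrightarrow> x + y \<in> base_ring"
  by (metis base_ringE in_base_ring to_fract_add)

lemma base_ring_mult: "x \<in> base_ring \<Longrightarrow> y \<in> base_ring \<Longrightarrow> x * y \<in> base_ring"
  by (metis base_ringE in_base_ring to_fract_mult)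

lemma subspace_base_ring: "fract_mod.subspace base_ring"
  by (rule fract_mod.subspaceI) (simp_all add: base_ring_add base_ring_mult)

lemma subspace_base_scale:
  "fract_mod.subspace I \<Longrightarrow> x \<in> I \<Longrightarrow> r \<in> base_ring \<Longrightarrow> r * x \<in> I"
  by (metis base_ringE fract_mod.subspace_scale)

text \<open>Turns a condition \<open>r * x \<in> I\<close> into membership in a submodule, so that
  minimality of spans and products reduces it to generators.\<close>

lemma subspace_scaled: "fract_mod.subspace I \<Longrightarrow> fract_mod.subspace {x. r * x \<in> I}"
  by (rule fract_mod.subspaceI)
    (simp_all add: fract_mod.subspace_0 distrib_left mult.left_commute[of r]
      fract_mod.subspace_add fract_mod.subspace_scale)

lemma fract_repr:
  obtains a b where "x = to_fract a / to_fract b" "b \<noteq> (0::'a::idom)"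
  by (metis Fract_cases Fract_conv_to_fract)

lemma nonzero_idealsI:
  assumes "fract_mod.subspace I" "x \<in> I" "x \<noteq> 0"
    and "d \<noteq> 0" "\<And>x. x \<in> I \<Longrightarrow> to_fract d * x \<in> base_ring"
  shows "I \<in> nonzero_ideals"
  using assms unfolding nonzero_ideals_def by blast

lemma nonzero_ideals_subspace: "I \<in> nonzero_ideals \<Longrightarrow> fract_mod.subspace I"
  by (simp add: nonzero_ideals_def)

lemma nonzero_ideals_denom:
  assumes "I \<in> nonzero_ideals"
  obtains d where "d \<noteq> 0" "\<And>x. x \<in> I \<Longrightarrow> to_fract d * x \<in> base_ring"
  using assms by (auto simp: nonzero_ideals_def)

lemma nonzero_ideals_nonzero:
  assumes "I \<in> nonzero_ideals"
  obtains x where "x \<in> I" "x \<noteq> 0"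
  using assms fract_mod.subspace_0[OF nonzero_ideals_subspace[OF assms]]
  by (auto simp: nonzero_ideals_def)

lemma nonzero_ideals_numerator:
  assumes "I \<in> nonzero_ideals"
  obtains a where "a \<noteq> 0" "to_fract a \<in> I"
proof -
  obtain x where x: "x \<in> I" "x \<noteq> 0" by (rule nonzero_ideals_nonzero[OF assms])
  obtain a b where ab: "x = to_fract a / to_fract b" "b \<noteq> 0" by (rule fract_repr)
  have "to_fract b * x \<in> I"
    using assms x nonzero_ideals_subspace fract_mod.subspace_scale by blast
  then show ?thesis
    using that[of a] x ab by auto
qed

lemma nonzero_ideals_base: "fract_mod.subspace I \<Longrightarrow> x \<in> I \<Longrightarrow> x \<noteq> 0 \<Longrightarrow> I \<subseteq> base_ring
    \<Longrightarrow> I \<in> nonzero_ideals"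
  by (rule nonzero_idealsI[where d=1]) auto

lemma subspace_colon: "fract_mod.subspace J \<Longrightarrow> fract_mod.subspace (colon J I)"
  by (rule fract_mod.subspaceI)
    (simp_all add: colon_def fract_mod.subspace_0 distrib_right mult.assoc
      fract_mod.subspace_add fract_mod.subspace_scale)

text \<open>If \<open>d\<close> clears the denominators of \<open>I\<close> and \<open>b\<close> is
  in \<open>J\<close>, then \<open>d * b\<close> carries \<open>I\<close> into \<open>J\<close>. If
  \<open>e\<close> clears the denominators of \<open>J\<close> and \<open>a\<close> is in
  \<open>I\<close>, then \<open>e * a\<close> clears those of the colon.\<close>

lemma colon_nonzero_ideals:
  assumes I: "I \<in> nonzero_ideals" and J: "J \<in> nonzero_ideals"
  shows "colon J I \<in> nonzero_ideals"
proof -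
  obtain d where d: "d \<noteq> 0" "\<And>x. x \<in> I \<Longrightarrow> to_fract d * x \<in> base_ring"
    by (rule nonzero_ideals_denom[OF I]) blast
  obtain e where e: "e \<noteq> 0" "\<And>x. x \<in> J \<Longrightarrow> to_fract e * x \<in> base_ring"
    by (rule nonzero_ideals_denom[OF J]) blast
  obtain a where a: "a \<noteq> 0" "to_fract a \<in> I" by (rule nonzero_ideals_numerator[OF I])
  obtain b where b: "b \<noteq> 0" "to_fract b \<in> J" by (rule nonzero_ideals_numerator[OF J])
  show ?thesis
  proof (rule nonzero_idealsI)
    show "fract_mod.subspace (colon J I)"
      by (rule subspace_colon[OF nonzero_ideals_subspace[OF J]])
    show "to_fract (d * b) \<in> colon J I"
      unfolding colon_def
    proof clarify
      fix y assume "y \<in> I"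
      from subspace_base_scale[OF nonzero_ideals_subspace[OF J] b(2) d(2)[OF this]]
      show "to_fract (d * b) * y \<in> J" by (simp add: mult_ac)
    qed
    show "to_fract (d * b) \<noteq> 0" using d b by simp
    show "e * a \<noteq> 0" using e a by simp
    show "to_fract (e * a) * x \<in> base_ring" if "x \<in> colon J I" for x
    proof -
      have "x * to_fract a \<in> J" using that a by (simp add: colon_def)
      from e(2)[OF this] show ?thesis by (simp add: mult_ac)
    qed
  qed
qed

lemma mult_in_ideal_prod: "x \<in> I \<Longrightarrow> y \<in> J \<Longrightarrow> x * y \<in> ideal_prod I J"
  unfolding ideal_prod_def by (rule fract_mod.span_base) blast

lemma subspace_ideal_prod: "fract_mod.subspace (ideal_prod I J)"
  by (simp add: ideal_prod_def)

lemma ideal_prod_subset: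
  assumes "fract_mod.subspace N" "\<And>x y. x \<in> I \<Longrightarrow> y \<in> J \<Longrightarrow> x * y \<in> N"
  shows "ideal_prod I J \<subseteq> N"
  unfolding ideal_prod_def by (rule fract_mod.span_minimal) (use assms in auto)

lemma ideal_prod_colon_subset:
  assumes "fract_mod.subspace J"
  shows "ideal_prod I (colon J I) \<subseteq> J"
proof (rule ideal_prod_subset[OF assms])
  fix x y assume "x \<in> I" "y \<in> colon J I"
  then have "y * x \<in> J" by (simp add: colon_def)
  then show "x * y \<in> J" by (simp only: mult.commute[of x])
qed

lemma ideal_prod_mono: "I \<subseteq> I' \<Longrightarrow> J \<subseteq> J' \<Longrightarrow> ideal_prod I J \<subseteq> ideal_prod I' J'"
  by (rule ideal_prod_subset[OF subspace_ideal_prod]) (blast intro: mult_in_ideal_prod)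

lemma ideal_prod_nonzero_ideals:
  assumes I: "I \<in> nonzero_ideals" and J: "J \<in> nonzero_ideals"
  shows "ideal_prod I J \<in> nonzero_ideals"
proof -
  obtain d where d: "d \<noteq> 0" "\<And>x. x \<in> I \<Longrightarrow> to_fract d * x \<in> base_ring"
    by (rule nonzero_ideals_denom[OF I]) blast
  obtain e where e: "e \<noteq> 0" "\<And>x. x \<in> J \<Longrightarrow> to_fract e * x \<in> base_ring"
    by (rule nonzero_ideals_denom[OF J]) blast
  obtain x y where xy: "x \<in> I" "x \<noteq> 0" "y \<in> J" "y \<noteq> 0"
    using nonzero_ideals_nonzero[OF I] nonzero_ideals_nonzero[OF J] by metis
  have "ideal_prod I J \<subseteq> {z. to_fract (d * e) * z \<in> base_ring}"
  proof (rule ideal_prod_subset[OF subspace_scaled[OF subspace_base_ring]])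
    show "u * v \<in> {z. to_fract (d * e) * z \<in> base_ring}" if "u \<in> I" "v \<in> J" for u v
      using base_ring_mult[OF d(2)[OF that(1)] e(2)[OF that(2)]] by (simp add: mult_ac)
  qed
  then show ?thesis
    by (intro nonzero_idealsI[where x="x * y" and d="d * e"])
      (use xy d e in \<open>auto simp: subspace_ideal_prod mult_in_ideal_prod\<close>)
qed

subsection \<open>The \<open>t\<close>-operation\<close>

lemma v_op_iff: "y \<in> v_op S \<longleftrightarrow> (\<forall>x. (\<forall>s\<in>S. x * s \<in> base_ring) \<longrightarrow> y * x \<in> base_ring)"
  by (simp add: v_op_def colon_def)

lemma colon_base_span: "colon base_ring (fract_mod.span S) = colon base_ring S"
proof
  show "colon base_ring (fract_mod.span S) \<subseteq> colon base_ring S"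
    by (auto simp: colon_def fract_mod.span_base)
  show "colon base_ring S \<subseteq> colon base_ring (fract_mod.span S)"
  proof
    fix x assume "x \<in> colon base_ring S"
    then have "fract_mod.span S \<subseteq> {y. x * y \<in> base_ring}"
      by (intro fract_mod.span_minimal subspace_scaled subspace_base_ring) (auto simp: colon_def)
    then show "x \<in> colon base_ring (fract_mod.span S)" by (auto simp: colon_def)
  qed
qed

text \<open>Allows finite sets of generators to stand in for finitely generated ideals from here
  on.\<close>

lemma v_op_span: "v_op (fract_mod.span S) = v_op S"
  by (simp add: v_op_def colon_base_span)

lemma v_op_mono: "S \<subseteq> T \<Longrightarrow> v_op S \<subseteq> v_op T"
  unfolding v_op_iff subset_iff by blast

lemma subset_v_op: "S \<subseteq> v_op S"
  unfolding v_op_iff subset_iff by (metis mult.commute)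

lemma v_op_subset_v_op: "T \<subseteq> v_op S \<Longrightarrow> v_op T \<subseteq> v_op S"
  unfolding v_op_iff subset_iff by (metis mult.commute)

lemma subspace_v_op: "fract_mod.subspace (v_op S)"
  unfolding v_op_def by (rule subspace_colon[OF subspace_base_ring])

text \<open>A generating set of a finitely generated \<open>J\<close> replaces \<open>J\<close>. It
  must contain a nonzero element because \<open>t_op\<close> ranges over nonzero ideals
  only.\<close>

lemma t_op_iff:
  assumes I: "I \<in> nonzero_ideals"
  shows "y \<in> t_op I \<longleftrightarrow> (\<exists>S. finite S \<and> S \<subseteq> I \<and> (\<exists>s\<in>S. s \<noteq> 0) \<and> y \<in> v_op S)"
proof
  assume "y \<in> t_op I"
  then obtain J S where J: "J \<in> nonzero_ideals" "J \<subseteq> I" "y \<in> v_op J" "finite S" "J = fract_mod.span S"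
    unfolding t_op_def ideal_fg_def by blast
  have "\<exists>s\<in>S. s \<noteq> 0"
  proof (rule ccontr)
    assume "\<not> (\<exists>s\<in>S. s \<noteq> 0)"
    then have "J \<subseteq> {0}" unfolding J(5) by (intro fract_mod.span_minimal) auto
    then show False using nonzero_ideals_nonzero[OF J(1)] by blast
  qed
  moreover have "S \<subseteq> I" using J fract_mod.span_superset by blast
  moreover have "y \<in> v_op S" using J(3) unfolding J(5) v_op_span .
  ultimately show "\<exists>S. finite S \<and> S \<subseteq> I \<and> (\<exists>s\<in>S. s \<noteq> 0) \<and> y \<in> v_op S"
    using J(4) by blast
next
  assume "\<exists>S. finite S \<and> S \<subseteq> I \<and> (\<exists>s\<in>S. s \<noteq> 0) \<and> y \<in> v_op S"
  then obtain S s where S: "finite S" "S \<subseteq> I" "s \<in> S" "s \<noteq> 0" "y \<in> v_op S" by blast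
  have sub: "fract_mod.span S \<subseteq> I"
    using S nonzero_ideals_subspace[OF I] by (intro fract_mod.span_minimal)
  obtain d where d: "d \<noteq> 0" "\<And>x. x \<in> I \<Longrightarrow> to_fract d * x \<in> base_ring"
    by (rule nonzero_ideals_denom[OF I]) blast
  have "y \<in> v_op (fract_mod.span S)" unfolding v_op_span by (rule S(5))
  moreover have "fract_mod.span S \<in> nonzero_ideals"
    by (rule nonzero_idealsI[where x=s and d=d]) (use S d sub in \<open>auto intro: fract_mod.span_base\<close>)
  ultimately show "y \<in> t_op I"
    unfolding t_op_def ideal_fg_def using S(1) sub by blast
qed

lemma subset_t_op:
  assumes I: "I \<in> nonzero_ideals"
  shows "I \<subseteq> t_op I"
proof
  fix x assume "x \<in> I"
  moreover obtain y where "y \<in> I" "y \<noteq> 0" by (rule nonzero_ideals_nonzero[OF I])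
  ultimately show "x \<in> t_op I"
    unfolding t_op_iff[OF I] using subset_v_op[of "{x, y}"] by (intro exI[of _ "{x, y}"]) blast
qed

lemma t_op_nonzero_ideals:
  assumes I: "I \<in> nonzero_ideals"
  shows "t_op I \<in> nonzero_ideals"
proof -
  obtain d where d: "d \<noteq> 0" "\<And>x. x \<in> I \<Longrightarrow> to_fract d * x \<in> base_ring"
    by (rule nonzero_ideals_denom[OF I]) blast
  obtain z where z: "z \<in> I" "z \<noteq> 0" by (rule nonzero_ideals_nonzero[OF I])
  show ?thesis
  proof (rule nonzero_idealsI)
    show "z \<in> t_op I" "z \<noteq> 0" "d \<noteq> 0" using z d subset_t_op[OF I] by auto
    \<comment> \<open>A denominator of \<open>I\<close> carries every \<open>S \<subseteq> I\<close>
      into D, hence also carries \<open>v_op S\<close> into D.\<close>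
    show "to_fract d * x \<in> base_ring" if "x \<in> t_op I" for x
      using that d unfolding t_op_iff[OF I] v_op_iff by (metis mult.commute subsetD)
    show "fract_mod.subspace (t_op I)"
    proof (rule fract_mod.subspaceI)
      show "0 \<in> t_op I"
        using subset_t_op[OF I] fract_mod.subspace_0[OF nonzero_ideals_subspace[OF I]] by blast
      show "to_fract c * x \<in> t_op I" if "x \<in> t_op I" for x c
        using that unfolding t_op_iff[OF I] using fract_mod.subspace_scale[OF subspace_v_op] by blast
      show "x + y \<in> t_op I" if xy: "x \<in> t_op I" "y \<in> t_op I" for x y
      proof -
        obtain S where S: "finite S" "S \<subseteq> I" "\<exists>s\<in>S. s \<noteq> 0" "x \<in> v_op S"
          using xy(1) unfolding t_op_iff[OF I] by blast
        obtain T where T: "finite T" "T \<subseteq> I" "y \<in> v_op T"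
          using xy(2) unfolding t_op_iff[OF I] by blast
        have "x + y \<in> v_op (S \<union> T)"
          using S T v_op_mono[of S "S \<union> T"] v_op_mono[of T "S \<union> T"]
          by (intro fract_mod.subspace_add[OF subspace_v_op]) auto
        then show ?thesis
          unfolding t_op_iff[OF I] using S T by (intro exI[of _ "S \<union> T"]) auto
      qed
    qed
  qed
qed

text \<open>The t-operation has finite type: each of the finitely many elements of \<open>T\<close>
  needs only a finite subset of \<open>I\<close>, and the union of these subsets is still
  finite.\<close>

lemma t_op_idem:
  assumes I: "I \<in> nonzero_ideals"
  shows "t_op (t_op I) = t_op I"
proof
  show "t_op I \<subseteq> t_op (t_op I)"
    by (rule subset_t_op[OF t_op_nonzero_ideals[OF I]])
  show "t_op (t_op I) \<subseteq> t_op I"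
  proof
    fix y assume "y \<in> t_op (t_op I)"
    then obtain T t where T: "finite T" "T \<subseteq> t_op I" "t \<in> T" "y \<in> v_op T"
      unfolding t_op_iff[OF t_op_nonzero_ideals[OF I]] by blast
    have "\<forall>t\<in>T. \<exists>S. finite S \<and> S \<subseteq> I \<and> (\<exists>s\<in>S. s \<noteq> 0) \<and> t \<in> v_op S"
      using T(2) unfolding subset_iff t_op_iff[OF I] by blast
    then obtain S where S: "\<And>t. t \<in> T \<Longrightarrow> finite (S t)" "\<And>t. t \<in> T \<Longrightarrow> S t \<subseteq> I"
        "\<And>t. t \<in> T \<Longrightarrow> \<exists>s\<in>S t. s \<noteq> 0" "\<And>t. t \<in> T \<Longrightarrow> t \<in> v_op (S t)"
      by metis
    have "T \<subseteq> v_op (\<Union>t\<in>T. S t)"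
      using S(4) v_op_mono[of "S _" "\<Union>t\<in>T. S t"] by blast
    then have "y \<in> v_op (\<Union>t\<in>T. S t)" using T v_op_subset_v_op by blast
    then show "y \<in> t_op I"
      unfolding t_op_iff[OF I] using S T by (intro exI[of _ "\<Union>t\<in>T. S t"]) auto
  qed
qed

lemma proper_t_ideals_iff:
  "N \<in> proper_t_ideals \<longleftrightarrow> N \<in> nonzero_ideals \<and> N \<subseteq> base_ring \<and> 1 \<notin> N \<and> t_op N = N"
proof -
  have "base_ring \<subseteq> N" if "N \<in> nonzero_ideals" "1 \<in> N"
    using that subspace_base_scale[OF nonzero_ideals_subspace, of N 1] by auto
  then show ?thesis unfolding proper_t_ideals_def by auto
qed

text \<open>Zorn's lemma on the proper t-ideals above \<open>A\<close>, starting from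
  \<open>t_op A\<close>. The union of a chain is again a t-ideal because a finite subset of it
  already lies in one member.\<close>

lemma exists_t_Max:
  assumes A: "A \<in> nonzero_ideals" "A \<subseteq> base_ring" "1 \<notin> t_op A"
  obtains M where "M \<in> t_Max" "A \<subseteq> M"
proof -
  let ?P = "{N \<in> proper_t_ideals. A \<subseteq> N}"
  \<comment> \<open>Since \<open>A\<close> lies in D, the multiplier 1 carries every subset of
    \<open>A\<close> into D; testing \<open>v_op\<close> against it gives the inclusion.\<close>
  have "t_op A \<subseteq> base_ring"
    using A unfolding t_op_iff[OF A(1)] subset_iff v_op_iff by (metis mult_1_left mult_1_right)
  then have "t_op A \<in> ?P"
    using A by (simp add: proper_t_ideals_iff t_op_nonzero_ideals t_op_idem subset_t_op)
  then have "\<exists>M\<in>?P. \<forall>X\<in>?P. M \<subseteq> X \<longrightarrow> X = M"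
  proof (intro subset_Zorn_nonempty)
    fix C assume C: "C \<noteq> {}" "subset.chain ?P C"
    have P: "N \<in> nonzero_ideals" "N \<subseteq> base_ring" "1 \<notin> N" "t_op N = N" "A \<subseteq> N" if "N \<in> C" for N
      using C(2) that by (auto simp: subset.chain_def proper_t_ideals_iff)
    have fin: "\<exists>N\<in>C. S \<subseteq> N" if "finite S" "S \<subseteq> \<Union>C" for S
      using finite_subset_Union_chain[OF that C] by blast
    have sub: "fract_mod.subspace (\<Union>C)"
    proof (rule fract_mod.subspaceI)
      show "0 \<in> \<Union>C"
        using C(1) P(1) fract_mod.subspace_0[OF nonzero_ideals_subspace] by blast
      show "to_fract c * x \<in> \<Union>C" if "x \<in> \<Union>C" for c x
        using that P(1) fract_mod.subspace_scale[OF nonzero_ideals_subspace] by blast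
      show "x + y \<in> \<Union>C" if "x \<in> \<Union>C" "y \<in> \<Union>C" for x y
        using fin[of "{x, y}"] that P(1) fract_mod.subspace_add[OF nonzero_ideals_subspace]
        by (metis UnionI empty_subsetI finite.emptyI finite.insertI insert_subset)
    qed
    obtain z where z: "z \<in> A" "z \<noteq> 0" by (rule nonzero_ideals_nonzero[OF A(1)])
    have "z \<in> \<Union>C" using z C(1) P(5) by blast
    then have UC: "\<Union>C \<in> nonzero_ideals"
      by (rule nonzero_ideals_base[OF sub]) (use z P(2) in auto)
    have "t_op (\<Union>C) \<subseteq> \<Union>C"
    proof
      fix y assume "y \<in> t_op (\<Union>C)"
      then obtain S where S: "finite S" "S \<subseteq> \<Union>C" "\<exists>s\<in>S. s \<noteq> 0" "y \<in> v_op S"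
        unfolding t_op_iff[OF UC] by blast
      obtain N where N: "N \<in> C" "S \<subseteq> N" using fin S by blast
      then have "y \<in> t_op N" using S unfolding t_op_iff[OF P(1)[OF N(1)]] by blast
      then show "y \<in> \<Union>C" using P N by blast
    qed
    moreover have "A \<subseteq> \<Union>C" "\<Union>C \<subseteq> base_ring" "1 \<notin> \<Union>C"
      using C(1) P(2,3,5) by blast+
    ultimately show "\<Union>C \<in> ?P"
      using subset_t_op[OF UC] UC by (simp add: proper_t_ideals_iff subset_antisym)
  qed blast
  then obtain M where M: "M \<in> ?P" "\<forall>X\<in>?P. M \<subseteq> X \<longrightarrow> X = M" ..
  then have "M \<in> t_Max"
    unfolding t_Max_def by (simp add: subset_trans[of A M])
  then show ?thesis using M(1) that by simp
qed

lemma t_Max_props: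
  assumes "M \<in> t_Max"
  shows "M \<in> nonzero_ideals" "M \<subseteq> base_ring" "1 \<notin> M" "t_op M = M" "0 \<in> M"
  using assms fract_mod.subspace_0[OF nonzero_ideals_subspace]
  by (auto simp: t_Max_def proper_t_ideals_iff)

text \<open>Suppose \<open>a * b\<close> is in \<open>M\<close>. By maximality no t-maximal ideal
  contains \<open>M\<close> and \<open>a\<close>, so 1 is in \<open>v_op S\<close> for a finite
  \<open>S\<close> in the ideal they generate. Multiplying by \<open>b\<close> moves
  \<open>S\<close> into \<open>M\<close> and puts \<open>b\<close> in the t-closure of
  \<open>M\<close>, which is \<open>M\<close>.\<close>

lemma t_Max_prime:
  assumes M: "M \<in> t_Max" and a: "a \<in> base_ring - M" and b: "b \<in> base_ring - M"
  shows "a * b \<in> base_ring - M"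
proof -
  note Mp = t_Max_props[OF M]
  note subM = nonzero_ideals_subspace[OF Mp(1)]
  have False if ab: "a * b \<in> M"
  proof -
    let ?A = "fract_mod.span (insert a M)"
    have AM: "M \<subseteq> ?A" "a \<in> ?A" using fract_mod.span_superset by blast+
    have A: "?A \<subseteq> base_ring"
      using Mp a subspace_base_ring by (intro fract_mod.span_minimal) auto
    have A': "?A \<in> nonzero_ideals"
      by (rule nonzero_ideals_base[of _ a]) (use A AM a Mp in auto)
    have "1 \<in> t_op ?A"
    proof (rule ccontr)
      assume "1 \<notin> t_op ?A"
      then obtain N where "N \<in> t_Max" "?A \<subseteq> N" using exists_t_Max A A' by blast
      then have "N = M" using AM M unfolding t_Max_def by blast
      then show False using \<open>?A \<subseteq> N\<close> AM a by blast
    qed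
    then obtain S s where S: "finite S" "S \<subseteq> ?A" "s \<in> S" "s \<noteq> 0" "1 \<in> v_op S"
      unfolding t_op_iff[OF A'] by blast
    have "?A \<subseteq> {x. b * x \<in> M}"
    proof (rule fract_mod.span_minimal[OF _ subspace_scaled[OF subM]])
      show "insert a M \<subseteq> {x. b * x \<in> M}"
        using ab b subspace_base_scale[OF subM] by (auto simp: mult.commute)
    qed
    then have "(*) b ` S \<subseteq> M" using S by auto
    moreover have "b * s \<noteq> 0" using b S Mp by auto
    moreover have "b \<in> v_op ((*) b ` S)"
      using S(5) by (auto simp: v_op_iff mult_ac)
    ultimately have "b \<in> t_op M"
      unfolding t_op_iff[OF Mp(1)] using S by (intro exI[of _ "(*) b ` S"]) auto
    then show False using Mp b by simp
  qed
  then show ?thesis using a b base_ring_mult by blast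
qed

subsection \<open>The \<open>w\<close>-operation\<close>

text \<open>By primality of \<open>M\<close> denominators outside \<open>M\<close> can be
  multiplied, so a sum of products has a single common denominator.\<close>

lemma ideal_prod_localization_iff:
  assumes M: "M \<in> t_Max" and I: "fract_mod.subspace I"
  shows "x \<in> ideal_prod I (localization_at M) \<longleftrightarrow> (\<exists>s\<in>base_ring - M. s * x \<in> I)"
proof
  let ?N = "{x. \<exists>s\<in>base_ring - M. s * x \<in> I}"
  note Mp = t_Max_props[OF M]
  have "fract_mod.subspace ?N"
  proof (rule fract_mod.subspaceI)
    show "0 \<in> ?N" using Mp fract_mod.subspace_0[OF I] by (auto intro!: exI[of _ 1])
    show "to_fract c * x \<in> ?N" if x: "x \<in> ?N" for c x
    proof -
      obtain s where s: "s \<in> base_ring - M" "s * x \<in> I" using x by blast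
      have "s * (to_fract c * x) \<in> I"
        using fract_mod.subspace_scale[OF I s(2), of c] by (simp add: mult.left_commute)
      then show ?thesis using s by blast
    qed
    show "x + y \<in> ?N" if xy: "x \<in> ?N" "y \<in> ?N" for x y
    proof -
      obtain s t where st: "s \<in> base_ring - M" "s * x \<in> I" "t \<in> base_ring - M" "t * y \<in> I"
        using xy by blast
      have "t * (s * x) + s * (t * y) \<in> I"
        using st subspace_base_scale[OF I] fract_mod.subspace_add[OF I] by blast
      then have "s * t * (x + y) \<in> I" by (simp add: algebra_simps)
      then show ?thesis using t_Max_prime[OF M st(1,3)] by blast
    qed
  qed
  then have "ideal_prod I (localization_at M) \<subseteq> ?N"
  proof (rule ideal_prod_subset)
    fix x y assume x: "x \<in> I" and "y \<in> localization_at M"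
    then obtain a s where y: "a \<in> base_ring" "s \<in> base_ring - M" "y = a / s"
      by (auto simp: localization_at_def)
    moreover have "s \<noteq> 0" using y Mp by blast
    ultimately have "s * (x * y) = a * x" by simp
    then have "s * (x * y) \<in> I" using subspace_base_scale[OF I x y(1)] by (simp only:)
    then show "x * y \<in> ?N" using y(2) by blast
  qed
  then show "\<exists>s\<in>base_ring - M. s * x \<in> I" if "x \<in> ideal_prod I (localization_at M)"
    using that by blast
next
  assume "\<exists>s\<in>base_ring - M. s * x \<in> I"
  then obtain s where s: "s \<in> base_ring - M" "s * x \<in> I" by blast
  have "1 / s \<in> localization_at M"
    unfolding localization_at_def using s one_in_base_ring by blast
  then have "(s * x) * (1 / s) \<in> ideal_prod I (localization_at M)"
    using s by (intro mult_in_ideal_prod)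
  moreover have "s \<noteq> 0" using s t_Max_props[OF M] by blast
  ultimately show "x \<in> ideal_prod I (localization_at M)" by simp
qed

text \<open>A finite set of generators of a Glaz--Vasconcelos ideal. The nonzero element is
  automatic unless the domain is a field.\<close>

definition gv_set :: "'a::idom set \<Rightarrow> bool" where
  "gv_set S \<longleftrightarrow> finite S \<and> (\<exists>s\<in>S. s \<noteq> 0) \<and>
     (\<forall>x. (\<forall>s\<in>S. x * to_fract s \<in> base_ring) \<longrightarrow> x \<in> base_ring)"

lemma gv_setD: "gv_set S \<Longrightarrow> (\<And>s. s \<in> S \<Longrightarrow> x * to_fract s \<in> base_ring) \<Longrightarrow> x \<in> base_ring"
  by (simp add: gv_set_def)

lemma gv_set_one: "gv_set {1}"
  by (simp add: gv_set_def)

text \<open>Forwards, the ideal of all \<open>r\<close> in D with \<open>r * x \<in> I\<close> lies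
  in no t-maximal ideal, so its t-closure contains 1, which is witnessed by a finite set. Backwards,
  a Glaz-Vasconcelos set inside a t-maximal \<open>M\<close> would put 1 in \<open>M\<close>; an
  element of the set outside \<open>M\<close> serves as denominator.\<close>

lemma w_op_iff:
  assumes I: "I \<in> nonzero_ideals"
  shows "x \<in> w_op I \<longleftrightarrow> (\<exists>S. gv_set S \<and> (\<forall>s\<in>S. to_fract s * x \<in> I))"
proof
  note subI = nonzero_ideals_subspace[OF I]
  assume x: "x \<in> w_op I"
  let ?A = "{r \<in> base_ring. r * x \<in> I}"
  have subA: "fract_mod.subspace ?A"
    using fract_mod.subspace_inter[OF subspace_base_ring subspace_scaled[OF subI, of x]]
    by (simp add: Int_def mult.commute)
  obtain a b where ab: "x = to_fract a / to_fract b" "b \<noteq> 0" by (rule fract_repr)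
  obtain c where c: "c \<noteq> 0" "to_fract c \<in> I" by (rule nonzero_ideals_numerator[OF I])
  \<comment> \<open>A nonzero element of \<open>?A\<close>: \<open>b\<close> clears the denominator
    of \<open>x\<close>, and \<open>c\<close> moves the result into \<open>I\<close>.\<close>
  have "to_fract (b * c) * x = to_fract a * to_fract c" using ab by simp
  then have "to_fract (b * c) \<in> ?A"
    using fract_mod.subspace_scale[OF subI c(2), of a] by (simp del: to_fract_mult)
  then have A: "?A \<in> nonzero_ideals"
    by (rule nonzero_ideals_base[OF subA]) (use ab c in auto)
  have "1 \<in> t_op ?A"
  proof (rule ccontr)
    assume "1 \<notin> t_op ?A"
    then obtain M where M: "M \<in> t_Max" "?A \<subseteq> M" by (rule exists_t_Max[OF A, rotated]) auto
    then have "x \<in> ideal_prod I (localization_at M)" using x by (auto simp: w_op_def)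
    then show False using M unfolding ideal_prod_localization_iff[OF M(1) subI] by blast
  qed
  then obtain S where S: "finite S" "S \<subseteq> ?A" "\<exists>s\<in>S. s \<noteq> 0" "1 \<in> v_op S"
    unfolding t_op_iff[OF A] by blast
  \<comment> \<open>\<open>S\<close> consists of elements of D, and \<open>1 \<in> v_op S\<close>
    says exactly that multipliers of \<open>S\<close> into D lie in D; its preimage in D is
    therefore a \<open>gv_set\<close>.\<close>
  then obtain S' where S': "S = to_fract ` S'" "finite S'"
    using finite_subset_image[of S to_fract UNIV] unfolding base_ring_def by blast
  have "gv_set S'" using S S' by (auto simp: gv_set_def v_op_iff)
  then show "\<exists>S. gv_set S \<and> (\<forall>s\<in>S. to_fract s * x \<in> I)" using S S' by blast
next
  assume "\<exists>S. gv_set S \<and> (\<forall>s\<in>S. to_fract s * x \<in> I)"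
  then obtain S where S: "gv_set S" "\<forall>s\<in>S. to_fract s * x \<in> I" by blast
  have "x \<in> ideal_prod I (localization_at M)" if M: "M \<in> t_Max" for M
  proof -
    note Mp = t_Max_props[OF M]
    have "\<not> to_fract ` S \<subseteq> M"
    proof
      assume "to_fract ` S \<subseteq> M"
      moreover have "1 \<in> v_op (to_fract ` S)" using S(1) by (auto simp: gv_set_def v_op_iff)
      ultimately have "1 \<in> t_op M"
        unfolding t_op_iff[OF Mp(1)] using S(1)
        by (intro exI[of _ "to_fract ` S"]) (auto simp: gv_set_def)
      then show False using Mp by simp
    qed
    then show ?thesis
      unfolding ideal_prod_localization_iff[OF M nonzero_ideals_subspace[OF I]] using S by auto
  qed
  then show "x \<in> w_op I" by (auto simp: w_op_def)
qed

lemma subset_w_op: "I \<in> nonzero_ideals \<Longrightarrow> I \<subseteq> w_op I"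
  using gv_set_one by (auto simp: w_op_iff intro!: exI[of _ "{1}"])

lemma w_op_mono: "I \<subseteq> J \<Longrightarrow> w_op I \<subseteq> w_op J"
  unfolding w_op_def by (rule INF_superset_mono[OF order_refl ideal_prod_mono[OF _ order_refl]])

lemma subspace_w_op: "fract_mod.subspace (w_op I)"
  unfolding w_op_def by (rule fract_mod.subspace_Int) (rule subspace_ideal_prod)

lemma w_op_nonzero_ideals:
  assumes I: "I \<in> nonzero_ideals"
  shows "w_op I \<in> nonzero_ideals"
proof -
  obtain d where d: "d \<noteq> 0" "\<And>x. x \<in> I \<Longrightarrow> to_fract d * x \<in> base_ring"
    by (rule nonzero_ideals_denom[OF I]) blast
  obtain z where z: "z \<in> I" "z \<noteq> 0" by (rule nonzero_ideals_nonzero[OF I])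
  show ?thesis
  proof (rule nonzero_idealsI[OF subspace_w_op])
    show "z \<in> w_op I" "z \<noteq> 0" "d \<noteq> 0" using z d subset_w_op[OF I] by auto
    fix x assume "x \<in> w_op I"
    then obtain S where S: "gv_set S" "\<And>s. s \<in> S \<Longrightarrow> to_fract s * x \<in> I"
      using w_op_iff[OF I] by blast
    \<comment> \<open>The denominator of \<open>I\<close> still works for its w-closure: all of
      \<open>S\<close> multiplies \<open>to_fract d * x\<close> into D.\<close>
    show "to_fract d * x \<in> base_ring"
    proof (rule gv_setD[OF S(1)])
      fix s assume "s \<in> S"
      from d(2)[OF S(2)[OF this]] show "to_fract d * x * to_fract s \<in> base_ring"
        by (simp add: mult_ac)
    qed
  qed
qed

text \<open>The products \<open>s * t\<close> with \<open>t\<close> in \<open>T\<close> and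
  \<open>s\<close> in \<open>S t\<close> again form a \<open>gv_set\<close>: cancel the
  \<open>s\<close> for each fixed \<open>t\<close>, then the \<open>t\<close>.\<close>

lemma w_op_closed:
  assumes I: "I \<in> nonzero_ideals" and T: "gv_set T" "\<And>t. t \<in> T \<Longrightarrow> to_fract t * x \<in> w_op I"
  shows "x \<in> w_op I"
proof -
  have "\<forall>t\<in>T. \<exists>S. gv_set S \<and> (\<forall>s\<in>S. to_fract s * (to_fract t * x) \<in> I)"
    using T(2) w_op_iff[OF I] by blast
  then obtain S where S: "\<And>t. t \<in> T \<Longrightarrow> gv_set (S t)"
      "\<And>t s. t \<in> T \<Longrightarrow> s \<in> S t \<Longrightarrow> to_fract s * (to_fract t * x) \<in> I"
    by metis
  let ?P = "\<Union>t\<in>T. (\<lambda>s. s * t) ` S t"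
  have "gv_set ?P"
    unfolding gv_set_def
  proof (intro conjI allI impI)
    show "finite ?P" using T S by (auto simp: gv_set_def)
    obtain t where t: "t \<in> T" "t \<noteq> 0" using T by (auto simp: gv_set_def)
    moreover obtain s where "s \<in> S t" "s \<noteq> 0" using S(1)[OF t(1)] by (auto simp: gv_set_def)
    ultimately have "s * t \<in> ?P" "s * t \<noteq> 0" by auto
    then show "\<exists>s\<in>?P. s \<noteq> 0" by blast
    fix y assume "\<forall>s\<in>?P. y * to_fract s \<in> base_ring"
    then have "y * to_fract t * to_fract s \<in> base_ring" if "t \<in> T" "s \<in> S t" for t s
      using that by (auto simp: mult_ac)
    then have "y * to_fract t \<in> base_ring" if "t \<in> T" for t
      using that gv_setD[OF S(1)[OF that], of "y * to_fract t"] by simp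
    then show "y \<in> base_ring" by (rule gv_setD[OF T(1)])
  qed
  moreover have "\<forall>p\<in>?P. to_fract p * x \<in> I" using S(2) by (auto simp: mult_ac)
  ultimately show ?thesis using w_op_iff[OF I] by blast
qed

lemma w_op_idem: "I \<in> nonzero_ideals \<Longrightarrow> w_op (w_op I) = w_op I"
  by (rule subset_antisym[OF subsetI subset_w_op[OF w_op_nonzero_ideals]])
    (auto simp: w_op_iff[OF w_op_nonzero_ideals] intro: w_op_closed)

subsection \<open>Extension of ideals to the polynomial ring\<close>

lemma coeff_mult_const: "coeff (p * [:c:]) i = coeff p i * c"
  by (simp add: mult.commute)

lemma to_fract_quot_eq_iff:
  "b \<noteq> 0 \<Longrightarrow> d \<noteq> 0 \<Longrightarrow>
    to_fract a / to_fract b = to_fract c / to_fract d \<longleftrightarrow> a * d = c * (b::'a::idom)"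
  by (simp add: frac_eq_eq flip: to_fract_mult)

text \<open>The ideal \<open>I[X]\<close>, where polynomials over \<open>K\<close> are written as quotients \<open>q / d\<close> with
  \<open>q\<close> in \<open>D[X]\<close> and \<open>d\<close> in \<open>D\<close>.\<close>

definition poly_ext :: "'a::idom fract set \<Rightarrow> 'a poly fract set" where
  "poly_ext I = {to_fract q / to_fract [:d:] | q d.
     d \<noteq> 0 \<and> (\<forall>i. to_fract (coeff q i) / to_fract d \<in> I)}"

text \<open>Any representation may be used to test membership: if \<open>q / d = p / e\<close> with
  constant denominators, cross-multiplication gives equality coefficient by coefficient.\<close>

lemma poly_ext_iff:
  assumes d: "d \<noteq> 0"
  shows "to_fract q / to_fract [:d:] \<in> poly_ext I \<longleftrightarrow>
    (\<forall>i. to_fract (coeff q i) / to_fract d \<in> I)"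
proof
  assume "to_fract q / to_fract [:d:] \<in> poly_ext I"
  then obtain p e where pe: "e \<noteq> 0" "\<forall>i. to_fract (coeff p i) / to_fract e \<in> I"
      "to_fract q / to_fract [:d:] = to_fract p / to_fract [:e:]"
    unfolding poly_ext_def by blast
  then have "q * [:e:] = p * [:d:]"
    using d to_fract_quot_eq_iff[of "[:d:]" "[:e:]" q p] by simp
  then have "smult e q = smult d p" by simp
  then have "coeff q i * e = coeff p i * d" for i
    by (metis coeff_smult mult.commute)
  then have "to_fract (coeff q i) / to_fract d = to_fract (coeff p i) / to_fract e" for i
    using d pe(1) by (simp add: to_fract_quot_eq_iff)
  then show "\<forall>i. to_fract (coeff q i) / to_fract d \<in> I" using pe(2) by simp
next
  assume "\<forall>i. to_fract (coeff q i) / to_fract d \<in> I"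
  then show "to_fract q / to_fract [:d:] \<in> poly_ext I" unfolding poly_ext_def using d by blast
qed

lemma poly_extE:
  assumes "x \<in> poly_ext I"
  obtains q d where "x = to_fract q / to_fract [:d:]" "d \<noteq> 0"
    "\<And>i. to_fract (coeff q i) / to_fract d \<in> I"
  using assms unfolding poly_ext_def by blast

lemma quot_in_base_ring_iff:
  assumes "d \<noteq> 0"
  shows "to_fract a / to_fract d \<in> base_ring \<longleftrightarrow> d dvd a"
proof
  assume "to_fract a / to_fract d \<in> base_ring"
  then obtain c where "to_fract a / to_fract d = to_fract c / to_fract 1"
    by (metis base_ringE div_by_1 to_fract_1)
  then have "a = c * d" using assms by (subst (asm) to_fract_quot_eq_iff) auto
  then show "d dvd a" by simp
next
  assume "d dvd a"
  then show "to_fract a / to_fract d \<in> base_ring" using assms by (auto elim!: dvdE)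
qed

text \<open>A nonzero constant divides a polynomial iff it divides all the coefficients.\<close>

lemma poly_ext_base_ring: "poly_ext (base_ring :: 'a::idom fract set) = base_ring" (is "?L = ?R")
proof
  show "?L \<subseteq> ?R"
    by (auto elim!: poly_extE simp: quot_in_base_ring_iff const_poly_dvd_iff)
  show "?R \<subseteq> ?L"
  proof
    fix x assume "x \<in> ?R"
    then obtain q where "x = to_fract q / to_fract [:1:]"
      by (metis base_ringE div_by_1 one_pCons to_fract_1)
    then show "x \<in> ?L" using poly_ext_iff[of 1 q base_ring] by simp
  qed
qed

text \<open>Coefficients of a product are sums of products of coefficients. With \<open>I\<close>
  and \<open>J\<close> arbitrary sets this one form serves scaling by D[X], products, colons and the
  clearing of denominators.\<close>

lemma poly_ext_mult:
  assumes x: "x \<in> poly_ext I" and y: "y \<in> poly_ext J" and N: "fract_mod.subspace N"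
    and IJ: "\<And>a b. a \<in> I \<Longrightarrow> b \<in> J \<Longrightarrow> a * b \<in> N"
  shows "x * y \<in> poly_ext N"
proof -
  obtain q d where q: "x = to_fract q / to_fract [:d:]" "d \<noteq> 0"
      "\<And>i. to_fract (coeff q i) / to_fract d \<in> I"
    using x by (rule poly_extE) blast
  obtain p e where p: "y = to_fract p / to_fract [:e:]" "e \<noteq> 0"
      "\<And>i. to_fract (coeff p i) / to_fract e \<in> J"
    using y by (rule poly_extE) blast
  have "to_fract (coeff (q * p) i) / to_fract (d * e) =
      (\<Sum>j\<le>i. (to_fract (coeff q j) / to_fract d) * (to_fract (coeff p (i - j)) / to_fract e))" for i
    by (simp add: coeff_mult sum_divide_distrib)
  also have "\<dots> i \<in> N" for i
    by (intro fract_mod.subspace_sum[OF N] IJ q p)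
  finally have "to_fract (q * p) / to_fract [:d * e:] \<in> poly_ext N"
    using q p by (subst poly_ext_iff) auto
  moreover have "x * y = to_fract (q * p) / to_fract ([:d:] * [:e:])"
    unfolding to_fract_mult q p by simp
  ultimately show ?thesis by (simp add: mult.commute)
qed

lemma subspace_poly_ext:
  assumes I: "fract_mod.subspace I"
  shows "fract_mod.subspace (poly_ext I)"
proof (rule fract_mod.subspaceI)
  have "to_fract 0 / to_fract [:1:] \<in> poly_ext I"
    using fract_mod.subspace_0[OF I] by (subst poly_ext_iff) auto
  then show "0 \<in> poly_ext I" by simp
  show "to_fract c * x \<in> poly_ext I" if "x \<in> poly_ext I" for c x
    by (rule poly_ext_mult[of _ base_ring _ I])
      (use that I in \<open>simp_all add: poly_ext_base_ring subspace_base_scale\<close>)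
  show "x + y \<in> poly_ext I" if xy: "x \<in> poly_ext I" "y \<in> poly_ext I" for x y
  proof -
    obtain q d where q: "x = to_fract q / to_fract [:d:]" "d \<noteq> 0"
        "\<And>i. to_fract (coeff q i) / to_fract d \<in> I"
      using xy(1) by (rule poly_extE) blast
    obtain p e where p: "y = to_fract p / to_fract [:e:]" "e \<noteq> 0"
        "\<And>i. to_fract (coeff p i) / to_fract e \<in> I"
      using xy(2) by (rule poly_extE) blast
    have "to_fract (coeff (q * [:e:] + p * [:d:]) i) / to_fract (d * e) =
        to_fract (coeff q i) / to_fract d + to_fract (coeff p i) / to_fract e" for i
      using q p by (simp add: add_frac_eq mult_ac)
    also have "\<dots> i \<in> I" for i by (intro fract_mod.subspace_add[OF I] q p)
    finally have "to_fract (q * [:e:] + p * [:d:]) / to_fract [:d * e:] \<in> poly_ext I"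
      using q p by (subst poly_ext_iff) auto
    moreover have "x + y = to_fract (q * [:e:] + p * [:d:]) / to_fract ([:d:] * [:e:])"
      unfolding to_fract_mult to_fract_add q p using q p by (simp add: add_frac_eq)
    ultimately show ?thesis by (simp add: mult.commute)
  qed
qed

section \<open>The embedding of K into the fraction field of D[X]\<close>

definition fract_const :: "'a::idom fract \<Rightarrow> 'a poly fract" where
  "fract_const x = (SOME y. \<exists>a b. b \<noteq> 0 \<and> x = to_fract a / to_fract b \<and>
     y = to_fract [:a:] / to_fract [:b:])"

text \<open>The choice made in \<open>fract_const\<close> is harmless: cross-multiplication shows
  that all representations of an element give the same quotient of constants.\<close>

lemma fract_const_quot:
  assumes "b \<noteq> 0"
  shows "fract_const (to_fract a / to_fract b) = to_fract [:a:] / to_fract [:b:]"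
  unfolding fract_const_def
proof (rule some_equality)
  fix y assume "\<exists>a' b'. b' \<noteq> 0 \<and> to_fract a / to_fract b = to_fract a' / to_fract b' \<and>
    y = to_fract [:a':] / to_fract [:b':]"
  then show "y = to_fract [:a:] / to_fract [:b:]"
    using assms by (auto simp: to_fract_quot_eq_iff mult.commute)
qed (use assms in blast)

lemma fract_const_to_fract: "fract_const (to_fract a) = to_fract [:a:]"
  using fract_const_quot[of 1 a] by (simp flip: one_pCons)

lemma fract_const_mult: "fract_const (x * y) = fract_const x * fract_const y"
proof -
  obtain a b where x: "x = to_fract a / to_fract b" "b \<noteq> 0" by (rule fract_repr)
  obtain c d where y: "y = to_fract c / to_fract d" "d \<noteq> 0" by (rule fract_repr)
  have "fract_const (x * y) = to_fract ([:a:] * [:c:]) / to_fract ([:b:] * [:d:])"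
    using x y fract_const_quot[of "b * d" "a * c"] by (simp add: mult.commute)
  then show ?thesis unfolding to_fract_mult by (simp add: x y fract_const_quot)
qed

lemma fract_const_add: "fract_const (x + y) = fract_const x + fract_const y"
proof -
  obtain a b where x: "x = to_fract a / to_fract b" "b \<noteq> 0" by (rule fract_repr)
  obtain c d where y: "y = to_fract c / to_fract d" "d \<noteq> 0" by (rule fract_repr)
  have xy: "x + y = to_fract (a * d + c * b) / to_fract (b * d)"
    using x y by (simp add: add_frac_eq)
  have "fract_const (x + y) = to_fract [:a * d + c * b:] / to_fract [:b * d:]"
    unfolding xy by (rule fract_const_quot) (use x y in simp)
  then have "fract_const (x + y) = to_fract ([:a:] * [:d:] + [:c:] * [:b:]) / to_fract ([:b:] * [:d:])"
    by (simp add: mult.commute)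
  then show ?thesis
    unfolding to_fract_mult to_fract_add using x y by (simp add: fract_const_quot add_frac_eq)
qed

text \<open>Contracting an extended ideal to K gives the ideal back, which is why extension is
  injective. The higher coefficients of a constant are zero, hence the assumption on
  \<open>I\<close>.\<close>

lemma fract_const_in_poly_ext_iff:
  assumes "0 \<in> I"
  shows "fract_const x \<in> poly_ext I \<longleftrightarrow> x \<in> I"
proof -
  obtain a b where x: "x = to_fract a / to_fract b" "b \<noteq> 0" by (rule fract_repr)
  show ?thesis
    using assms x by (auto simp: fract_const_quot poly_ext_iff coeff_pCons split: nat.splits)
qed

lemma fract_const_in_base_ring_iff: "fract_const x \<in> base_ring \<longleftrightarrow> x \<in> base_ring"
  using fract_const_in_poly_ext_iff[of base_ring x] by (simp add: poly_ext_base_ring)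

lemma subspace_fract_const_vimage:
  assumes "fract_mod.subspace N"
  shows "fract_mod.subspace {x. fract_const x \<in> N}"
  by (rule fract_mod.subspaceI)
    (use assms in \<open>simp_all add: fract_const_add fract_const_mult fract_const_to_fract
      fract_mod.subspace_add fract_mod.subspace_scale fract_mod.subspace_0
      fract_const_to_fract[of 0, simplified]\<close>)

text \<open>A polynomial is the sum of its coefficients times powers of X, so the constants coming
  from \<open>I\<close> generate \<open>poly_ext I\<close> over D[X].\<close>

lemma poly_ext_subset:
  assumes N: "fract_mod.subspace N" and I: "\<And>x. x \<in> I \<Longrightarrow> fract_const x \<in> N"
  shows "poly_ext I \<subseteq> N"
proof
  fix x assume "x \<in> poly_ext I"
  then obtain q d where q: "x = to_fract q / to_fract [:d:]" "d \<noteq> 0"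
      "\<And>i. to_fract (coeff q i) / to_fract d \<in> I"
    by (rule poly_extE) blast
  have "to_fract q = to_fract (\<Sum>i\<le>degree q. monom 1 i * [:coeff q i:])"
    by (subst poly_as_sum_of_monoms[symmetric]) (simp add: smult_monom)
  then have "x = (\<Sum>i\<le>degree q. to_fract (monom 1 i) * fract_const (to_fract (coeff q i) / to_fract d))"
    unfolding q(1) using q(2)
    by (simp add: sum_divide_distrib fract_const_quot del: mult_pCons_right)
  also have "\<dots> \<in> N"
    by (intro fract_mod.subspace_sum[OF N] fract_mod.subspace_scale[OF N] I q)
  finally show "x \<in> N" .
qed

lemma poly_ext_nonzero_ideals:
  assumes I: "I \<in> nonzero_ideals"
  shows "poly_ext I \<in> nonzero_ideals"
proof -
  note subI = nonzero_ideals_subspace[OF I]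
  obtain d where d: "d \<noteq> 0" "\<And>x. x \<in> I \<Longrightarrow> to_fract d * x \<in> base_ring"
    by (rule nonzero_ideals_denom[OF I]) blast
  obtain a where a: "a \<noteq> 0" "to_fract a \<in> I" by (rule nonzero_ideals_numerator[OF I])
  show ?thesis
  proof (rule nonzero_idealsI[OF subspace_poly_ext[OF subI]])
    show "to_fract [:a:] \<in> poly_ext I"
      using a fract_const_in_poly_ext_iff[OF fract_mod.subspace_0[OF subI]]
      by (metis fract_const_to_fract)
    show "to_fract [:a:] \<noteq> 0" "[:d:] \<noteq> 0" using a d by auto
    have "poly_ext I \<subseteq> {x. to_fract [:d:] * x \<in> base_ring}"
    proof (rule poly_ext_subset[OF subspace_scaled[OF subspace_base_ring]])
      fix x assume "x \<in> I"
      then have "fract_const (to_fract d * x) \<in> base_ring"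
        unfolding fract_const_in_base_ring_iff by (rule d(2))
      then show "fract_const x \<in> {x. to_fract [:d:] * x \<in> base_ring}"
        by (simp add: fract_const_mult fract_const_to_fract)
    qed
    then show "to_fract [:d:] * x \<in> base_ring" if "x \<in> poly_ext I" for x
      using that by blast
  qed
qed

lemma poly_ext_inj:
  assumes "0 \<in> I" "0 \<in> J" "poly_ext I = poly_ext J"
  shows "I = J"
  using assms fract_const_in_poly_ext_iff by (metis set_eqI)

text \<open>One inclusion is read off coefficients. For the other it suffices to treat constants,
  and pulling the target back to K reduces these to products of elements of \<open>I\<close> and
  \<open>J\<close>.\<close>

lemma poly_ext_ideal_prod:
  assumes I: "fract_mod.subspace I" and J: "fract_mod.subspace J"
  shows "poly_ext (ideal_prod I J) = ideal_prod (poly_ext I) (poly_ext J)"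
proof
  show "ideal_prod (poly_ext I) (poly_ext J) \<subseteq> poly_ext (ideal_prod I J)"
    by (rule ideal_prod_subset[OF subspace_poly_ext[OF subspace_ideal_prod]])
      (rule poly_ext_mult[OF _ _ subspace_ideal_prod mult_in_ideal_prod])
  have "ideal_prod I J \<subseteq> {x. fract_const x \<in> ideal_prod (poly_ext I) (poly_ext J)}"
    using fract_mod.subspace_0[OF I] fract_mod.subspace_0[OF J]
    by (intro ideal_prod_subset subspace_fract_const_vimage subspace_ideal_prod)
      (simp add: fract_const_mult mult_in_ideal_prod fract_const_in_poly_ext_iff)
  then show "poly_ext (ideal_prod I J) \<subseteq> ideal_prod (poly_ext I) (poly_ext J)"
    by (intro poly_ext_subset[OF subspace_ideal_prod]) blast
qed

text \<open>A multiplier \<open>u\<close> need not be a polynomial over K a priori. Multiplying by a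
  nonzero constant \<open>a\<close> of \<open>I\<close> shows that it is one; testing it on the
  other constants of \<open>I\<close> then places each coefficient in the colon.\<close>

lemma poly_ext_colon:
  assumes I: "I \<in> nonzero_ideals" and J: "fract_mod.subspace J"
  shows "poly_ext (colon J I) = colon (poly_ext J) (poly_ext I)"
proof
  note subI = nonzero_ideals_subspace[OF I]
  have "x * y \<in> poly_ext J" if "x \<in> poly_ext (colon J I)" "y \<in> poly_ext I" for x y
    by (rule poly_ext_mult[OF that J]) (simp add: colon_def)
  then show "poly_ext (colon J I) \<subseteq> colon (poly_ext J) (poly_ext I)"
    unfolding colon_def[of "poly_ext J"] by blast
  show "colon (poly_ext J) (poly_ext I) \<subseteq> poly_ext (colon J I)"
  proof
    fix u assume "u \<in> colon (poly_ext J) (poly_ext I)"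
    then have u: "u * fract_const y \<in> poly_ext J" if "y \<in> I" for y
      using that fract_const_in_poly_ext_iff[OF fract_mod.subspace_0[OF subI]]
      unfolding colon_def by blast
    obtain a where a: "a \<noteq> 0" "to_fract a \<in> I" by (rule nonzero_ideals_numerator[OF I])
    obtain q d where q: "u * fract_const (to_fract a) = to_fract q / to_fract [:d:]" "d \<noteq> 0"
      using u[OF a(2)] by (rule poly_extE) blast
    have "u * to_fract [:a:] * to_fract [:d:] = to_fract q"
      using q by (simp add: fract_const_to_fract)
    then have "u * to_fract ([:a:] * [:d:]) = to_fract q"
      unfolding to_fract_mult by (simp only: mult.assoc)
    then have "u * to_fract [:a * d:] = to_fract q" by (simp add: mult.commute)
    then have u': "u = to_fract q / to_fract [:a * d:]"
      using a q by (simp add: eq_divide_eq)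
    have "to_fract (coeff q i) / to_fract (a * d) * y \<in> J" if y: "y \<in> I" for y i
    proof -
      obtain b c where bc: "y = to_fract b / to_fract c" "c \<noteq> 0" by (rule fract_repr)
      have "u * fract_const y = to_fract (q * [:b:]) / to_fract ([:a * d:] * [:c:])"
        unfolding to_fract_mult u' bc(1) fract_const_quot[OF bc(2)] by simp
      then have "to_fract (q * [:b:]) / to_fract [:a * d * c:] \<in> poly_ext J"
        using u[OF y] by (simp add: mult_ac)
      then have "to_fract (coeff (q * [:b:]) i) / to_fract (a * d * c) \<in> J"
        using a q bc by (subst (asm) poly_ext_iff) auto
      moreover have "to_fract (coeff q i) / to_fract (a * d) * y =
          to_fract (coeff (q * [:b:]) i) / to_fract (a * d * c)"
        unfolding bc(1) times_divide_times_eq to_fract_mult[symmetric] by (simp only: mult_ac coeff_mult_const)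
      ultimately show ?thesis by (simp only:)
    qed
    then show "u \<in> poly_ext (colon J I)"
      unfolding u' using a q by (subst poly_ext_iff) (auto simp: colon_def)
  qed
qed

section \<open>McCoy's argument and the w-closure of extended ideals\<close>

text \<open>McCoy's argument, applied to the module \<open>D/A\<close>, no nonzero element of which is annihilated by
  all the coefficients of \<open>T\<close>.\<close>

lemma coeff_in_of_mult_coeff_in:
  fixes A :: "'a::idom set"
  assumes zero: "0 \<in> A" and diff: "\<And>a b. a \<in> A \<Longrightarrow> b \<in> A \<Longrightarrow> a - b \<in> A"
    and mult: "\<And>c a. a \<in> A \<Longrightarrow> c * a \<in> A"
    and closed: "\<And>a. (\<And>t i. t \<in> T \<Longrightarrow> coeff t i * a \<in> A) \<Longrightarrow> a \<in> A"
    and q: "\<And>t i. t \<in> T \<Longrightarrow> coeff (t * q) i \<in> A"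
  shows "coeff q k \<in> A"
proof -
  have add: "a + b \<in> A" if "a \<in> A" "b \<in> A" for a b
    using diff[OF that(1) diff[OF zero that(2)]] by simp
  have sum: "sum f B \<in> A" if "\<And>x. x \<in> B \<Longrightarrow> f x \<in> A" for f :: "nat \<Rightarrow> 'a" and B
    using that by (induction B rule: infinite_finite_induct) (auto simp: zero add)
  \<comment> \<open>Induction on a bound \<open>n\<close> for the number of coefficients of
    \<open>q\<close>; in the step, \<open>n\<close> is the index of the top coefficient.\<close>
  have "\<forall>k. coeff q k \<in> A" if "\<And>t i. t \<in> T \<Longrightarrow> coeff (t * q) i \<in> A" "\<And>i. i \<ge> n \<Longrightarrow> coeff q i = 0" for n
    using that
  proof (induction n arbitrary: q)
    case 0
    then show ?case using zero by simp
  next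
    case (Suc n)
    \<comment> \<open>Downward induction on \<open>i\<close>, from the leading coefficient of
      \<open>t\<close>.\<close>
    have *: "coeff t i * coeff q k \<in> A" if t: "t \<in> T" for t i k
    proof (cases "i \<le> degree t")
      case False
      then show ?thesis using zero by (simp add: coeff_eq_0)
    next
      case True
      then show ?thesis
      proof (induction "degree t - i" arbitrary: i k rule: less_induct)
        case less
        have above: "coeff t j * coeff q k \<in> A" if "j > i" for j k
        proof (cases "j \<le> degree t")
          case True
          then show ?thesis using less that by simp
        next
          case False
          then show ?thesis using zero by (simp add: coeff_eq_0)
        qed
        let ?rest = "\<Sum>j\<in>{..i + n} - {i}. coeff t j * coeff q (i + n - j)"
        have rest: "?rest \<in> A"
        proof (rule sum)
          fix j assume j: "j \<in> {..i + n} - {i}"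
          show "coeff t j * coeff q (i + n - j) \<in> A"
          proof (cases "j > i")
            case False
            then have "coeff q (i + n - j) = 0" using j by (intro Suc.prems(2)) auto
            then show ?thesis using zero by simp
          qed (rule above)
        qed
        \<comment> \<open>In this coefficient the terms with \<open>j < i\<close> vanish, as they
          involve \<open>q\<close> beyond index \<open>n\<close>, and those with
          \<open>j > i\<close> are in \<open>A\<close> by the inner induction. Only
          \<open>coeff t i * coeff q n\<close> is left.\<close>
        have "coeff (t * q) (i + n) = coeff t i * coeff q n + ?rest"
          unfolding coeff_mult by (subst sum.remove[of _ i]) auto
        then have lead: "coeff t i * coeff q n \<in> A"
          using diff[OF Suc.prems(1)[OF t, of "i + n"] rest] by simp
        \<comment> \<open>Removing the top term, now known to have its coefficient in
          \<open>A\<close>, keeps all products with \<open>T\<close> inside \<open>A\<close> and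
          makes the outer induction apply.\<close>
        define h where "h = smult (coeff t i) q - monom (coeff t i * coeff q n) n"
        have "\<forall>k. coeff h k \<in> A"
        proof (rule Suc.IH)
          show "coeff h j = 0" if "j \<ge> n" for j
            using that Suc.prems(2)[of j] by (cases "j = n") (auto simp: h_def)
          fix s j assume s: "s \<in> T"
          have "coeff (s * h) j = coeff t i * coeff (s * q) j -
              coeff (monom (coeff t i * coeff q n) n * s) j"
            by (simp add: h_def right_diff_distrib mult.commute)
          moreover have "coeff (monom (coeff t i * coeff q n) n * s) j \<in> A"
            unfolding coeff_monom_mult using mult[OF lead, of "coeff s (j - n)"] zero
            by (simp add: mult_ac)
          ultimately show "coeff (s * h) j \<in> A"
            using diff mult[OF Suc.prems(1)[OF s]] by simp
        qed
        then have "coeff h k \<in> A" ..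
        then show ?case using lead by (cases "k = n") (auto simp: h_def)
      qed
    qed
    then show ?case using closed by blast
  qed
  then show ?thesis using q coeff_eq_0[of q] by (metis Suc_le_eq)
qed

text \<open>A nonzero constant in the set forces \<open>x\<close> to be a polynomial over K; the
  property of \<open>S\<close> in D then applies to each coefficient.\<close>

lemma gv_set_const_polys:
  assumes S: "gv_set S"
  shows "gv_set ((\<lambda>s. [:s:]) ` S)"
  unfolding gv_set_def
proof (intro conjI allI impI)
  show "finite ((\<lambda>s. [:s:]) ` S)" "\<exists>p\<in>(\<lambda>s. [:s:]) ` S. p \<noteq> 0"
    using S by (auto simp: gv_set_def)
  obtain r where r: "r \<in> S" "r \<noteq> 0" using S by (auto simp: gv_set_def)
  fix x assume x: "\<forall>p\<in>(\<lambda>s. [:s:]) ` S. x * to_fract p \<in> base_ring"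
  then have "x * to_fract [:r:] \<in> base_ring" using r by blast
  then obtain q where "x * to_fract [:r:] = to_fract q" by (rule base_ringE)
  then have q: "x = to_fract q / to_fract [:r:]" using r by (simp add: eq_divide_eq)
  have "to_fract (coeff q i) / to_fract r \<in> base_ring" for i
  proof (rule gv_setD[OF S])
    fix s assume "s \<in> S"
    then have "to_fract (q * [:s:]) / to_fract [:r:] \<in> poly_ext base_ring"
      using x unfolding poly_ext_base_ring to_fract_mult by (simp add: q)
    then show "to_fract (coeff q i) / to_fract r * to_fract s \<in> base_ring"
      using r by (subst (asm) poly_ext_iff) (auto simp: mult.commute)
  qed
  then show "x \<in> base_ring"
    unfolding q poly_ext_base_ring[symmetric] using r by (subst poly_ext_iff) auto
qed

text \<open>An element of K carrying all coefficients of \<open>T\<close> into D carries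
  \<open>T\<close> into D[X], hence lies in D[X], and contraction puts it in D.\<close>

lemma gv_set_coeffs:
  assumes T: "gv_set T"
  shows "gv_set (\<Union>t\<in>T. coeff t ` {..degree t})"
  unfolding gv_set_def
proof (intro conjI allI impI)
  let ?S = "\<Union>t\<in>T. coeff t ` {..degree t}"
  show "finite ?S" using T by (auto simp: gv_set_def)
  obtain t where t: "t \<in> T" "t \<noteq> 0" using T by (auto simp: gv_set_def)
  then have "lead_coeff t \<in> ?S" "lead_coeff t \<noteq> 0" by auto
  then show "\<exists>s\<in>?S. s \<noteq> 0" by blast
  fix x assume x: "\<forall>s\<in>?S. x * to_fract s \<in> base_ring"
  have "fract_const x * to_fract t \<in> base_ring" if t: "t \<in> T" for t
  proof -
    obtain a b where ab: "x = to_fract a / to_fract b" "b \<noteq> 0" by (rule fract_repr)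
    have "x * to_fract (coeff t i) \<in> base_ring" for i
      using x t by (cases "i \<le> degree t") (auto simp: coeff_eq_0)
    then have "to_fract ([:a:] * t) / to_fract [:b:] \<in> poly_ext base_ring"
      using ab by (subst poly_ext_iff) auto
    then show ?thesis
      unfolding poly_ext_base_ring to_fract_mult by (simp add: ab fract_const_quot)
  qed
  then have "fract_const x \<in> base_ring" by (rule gv_setD[OF T])
  then show "x \<in> base_ring" by (simp add: fract_const_in_base_ring_iff)
qed

lemma poly_ext_w_op:
  assumes I: "I \<in> nonzero_ideals"
  shows "poly_ext (w_op I) = w_op (poly_ext I)"
proof
  note subI = nonzero_ideals_subspace[OF I] and extI = poly_ext_nonzero_ideals[OF I]
  note I0 = fract_mod.subspace_0[OF subI]
  show "poly_ext (w_op I) \<subseteq> w_op (poly_ext I)"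
  proof (rule poly_ext_subset[OF subspace_w_op])
    fix x assume "x \<in> w_op I"
    then obtain S where S: "gv_set S" "\<And>s. s \<in> S \<Longrightarrow> to_fract s * x \<in> I"
      using w_op_iff[OF I] by blast
    have "to_fract p * fract_const x \<in> poly_ext I" if p: "p \<in> (\<lambda>s. [:s:]) ` S" for p
    proof -
      obtain s where "s \<in> S" "p = [:s:]" using p by blast
      then show ?thesis
        using S(2)[of s] fract_const_in_poly_ext_iff[OF I0, of "to_fract s * x"]
        by (simp add: fract_const_mult fract_const_to_fract)
    qed
    then show "fract_const x \<in> w_op (poly_ext I)"
      unfolding w_op_iff[OF extI] using gv_set_const_polys[OF S(1)] by blast
  qed
  show "w_op (poly_ext I) \<subseteq> poly_ext (w_op I)"
  proof
    fix u assume "u \<in> w_op (poly_ext I)"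
    then obtain T where T: "gv_set T" "\<And>t. t \<in> T \<Longrightarrow> to_fract t * u \<in> poly_ext I"
      using w_op_iff[OF extI] by blast
    obtain d where d: "d \<noteq> 0" "\<And>x. x \<in> I \<Longrightarrow> to_fract d * x \<in> base_ring"
      by (rule nonzero_ideals_denom[OF I]) blast
    \<comment> \<open>The aim is to write \<open>u\<close> as a polynomial over K with constant
      denominator \<open>d\<close>, using that \<open>T\<close> detects membership in D[X].\<close>
    have "u * to_fract [:d:] * to_fract t \<in> base_ring" if "t \<in> T" for t
    proof -
      have "to_fract [:d:] * (to_fract t * u) \<in> poly_ext base_ring"
      proof (rule poly_ext_mult[OF _ T(2)[OF that] subspace_base_ring])
        \<comment> \<open>0 is included for the higher coefficients of the constant
          polynomial.\<close>
        have "fract_const (to_fract d) \<in> poly_ext {to_fract d, 0}"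
          by (subst fract_const_in_poly_ext_iff) auto
        then show "to_fract [:d:] \<in> poly_ext {to_fract d, 0}" by (simp add: fract_const_to_fract)
        show "a * b \<in> base_ring" if "a \<in> {to_fract d, 0}" "b \<in> I" for a b
          using that d(2) by auto
      qed
      then show ?thesis by (simp add: poly_ext_base_ring mult_ac)
    qed
    then have "u * to_fract [:d:] \<in> base_ring" by (rule gv_setD[OF T(1)])
    then obtain q where "u * to_fract [:d:] = to_fract q" by (rule base_ringE)
    then have u: "u = to_fract q / to_fract [:d:]" using d by (simp add: eq_divide_eq)
    note subW = subspace_w_op[of I]
    \<comment> \<open>The numerators over \<open>d\<close> of elements of the w-closure: the ideal
      of D to which McCoy's argument is applied.\<close>
    let ?A = "{a. to_fract a / to_fract d \<in> w_op I}"
    have "coeff q k \<in> ?A" for k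
    proof (rule coeff_in_of_mult_coeff_in[where T=T])
      show "0 \<in> ?A" using fract_mod.subspace_0[OF subW] by simp
      show "a - b \<in> ?A" if "a \<in> ?A" "b \<in> ?A" for a b
        using that fract_mod.subspace_diff[OF subW] by (simp add: diff_divide_distrib)
      show "c * a \<in> ?A" if "a \<in> ?A" for c a
        using that fract_mod.subspace_scale[OF subW, of "to_fract a / to_fract d" c] by simp
      show "coeff (t * q) i \<in> ?A" if "t \<in> T" for t i
      proof -
        have "to_fract (t * q) / to_fract [:d:] \<in> poly_ext I"
          using T(2)[OF that] by (simp add: u)
        then show ?thesis
          using d subset_w_op[OF I] by (subst (asm) poly_ext_iff) auto
      qed
      \<comment> \<open>The closure condition of McCoy's argument: the coefficients of
        \<open>T\<close> form a \<open>gv_set\<close> of D, and w-closures absorb such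
        multipliers.\<close>
      fix a assume a: "\<And>t i. t \<in> T \<Longrightarrow> coeff t i * a \<in> ?A"
      have "to_fract a / to_fract d \<in> w_op I"
        by (rule w_op_closed[OF I gv_set_coeffs[OF T(1)]]) (use a in auto)
      then show "a \<in> ?A" by simp
    qed
    then show "u \<in> poly_ext (w_op I)"
      unfolding u using d by (subst poly_ext_iff) auto
  qed
qed

section \<open>Descent of stability and regularity from D[X] to D\<close>

lemma w_stable_poly_ext_iff:
  assumes I: "I \<in> nonzero_ideals"
  shows "w_stable (poly_ext I) \<longleftrightarrow> w_stable I"
proof -
  let ?W = "w_op I"
  let ?E = "colon ?W ?W"
  let ?P = "ideal_prod ?W (colon ?E ?W)"
  have W: "?W \<in> nonzero_ideals" by (rule w_op_nonzero_ideals[OF I])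
  have E: "?E \<in> nonzero_ideals" by (rule colon_nonzero_ideals[OF W W])
  have C: "colon ?E ?W \<in> nonzero_ideals" by (rule colon_nonzero_ideals[OF W E])
  have P: "?P \<in> nonzero_ideals" by (rule ideal_prod_nonzero_ideals[OF W C])
  note sub = nonzero_ideals_subspace
  \<comment> \<open>On the right, \<open>poly_ext\<close> is pushed inwards through closure, product
    and colon down to \<open>?W\<close>; on the left, \<open>poly_ext ?W\<close> replaces the
    closure of \<open>poly_ext I\<close>. The two sides then coincide.\<close>
  have "w_stable (poly_ext I) \<longleftrightarrow> poly_ext (w_op ?P) = poly_ext ?E"
    unfolding w_stable_def Let_def poly_ext_w_op[OF I, symmetric] poly_ext_w_op[OF P]
      poly_ext_ideal_prod[OF sub[OF W] sub[OF C]] poly_ext_colon[OF W sub[OF E]]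
      poly_ext_colon[OF W sub[OF W]] ..
  also have "\<dots> \<longleftrightarrow> w_op ?P = ?E"
    using poly_ext_inj[OF fract_mod.subspace_0[OF subspace_w_op] fract_mod.subspace_0[OF sub[OF E]]]
    by auto
  finally show ?thesis by (simp add: w_stable_def Let_def)
qed

text \<open>If \<open>I[X]\<^sup>w = (I[X]\<^sup>2 J)\<^sup>w\<close>, then \<open>J\<close> lies in \<open>(I[X]\<^sup>w : I[X]\<^sup>2) = (I\<^sup>w : I\<^sup>2)[X]\<close>,
  so \<open>J\<close> may be replaced by an extended ideal.\<close>

lemma w_regular_of_poly_ext:
  assumes I: "I \<in> nonzero_ideals" and reg: "w_regular (poly_ext I)"
  shows "w_regular I"
proof -
  let ?Q = "ideal_prod I I"
  let ?C = "colon (w_op I) ?Q"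
  let ?P = "ideal_prod ?Q ?C"
  have W: "w_op I \<in> nonzero_ideals" by (rule w_op_nonzero_ideals[OF I])
  have Q: "?Q \<in> nonzero_ideals" by (rule ideal_prod_nonzero_ideals[OF I I])
  have C: "?C \<in> nonzero_ideals" by (rule colon_nonzero_ideals[OF Q W])
  have P: "?P \<in> nonzero_ideals" by (rule ideal_prod_nonzero_ideals[OF Q C])
  note sub = nonzero_ideals_subspace
  note extQ = poly_ext_ideal_prod[OF sub[OF I] sub[OF I]]
  obtain J where J: "J \<in> nonzero_ideals"
      "w_op (poly_ext I) = w_op (ideal_prod (poly_ext ?Q) J)"
    using reg unfolding w_regular_def extQ[symmetric] by blast
  have "ideal_prod (poly_ext ?Q) J \<subseteq> poly_ext (w_op I)"
    unfolding poly_ext_w_op[OF I] J(2)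
    by (intro subset_w_op ideal_prod_nonzero_ideals poly_ext_nonzero_ideals Q J)
  then have "x * y \<in> poly_ext (w_op I)" if "x \<in> J" "y \<in> poly_ext ?Q" for x y
    using mult_in_ideal_prod[OF that(2,1)] by (auto simp: mult.commute[of x])
  then have "J \<subseteq> colon (poly_ext (w_op I)) (poly_ext ?Q)"
    unfolding colon_def[of "poly_ext (w_op I)"] by blast
  then have "J \<subseteq> poly_ext ?C"
    unfolding poly_ext_colon[OF Q sub[OF W]] .
  then have "w_op (poly_ext I) \<subseteq> w_op (poly_ext ?P)"
    unfolding J(2) poly_ext_ideal_prod[OF sub[OF Q] sub[OF C]]
    by (intro w_op_mono ideal_prod_mono order_refl)
  then have "poly_ext (w_op I) \<subseteq> poly_ext (w_op ?P)"
    by (simp only: poly_ext_w_op[OF I] poly_ext_w_op[OF P])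
  \<comment> \<open>Contraction to the constants of K.\<close>
  then have "w_op I \<subseteq> w_op ?P"
    using fract_const_in_poly_ext_iff[OF fract_mod.subspace_0[OF subspace_w_op]] by blast
  \<comment> \<open>The reverse inclusion holds by the choice of \<open>?C\<close> as a colon,
    together with idempotence of the closure.\<close>
  moreover have "?P \<subseteq> w_op I"
    by (rule ideal_prod_colon_subset[OF subspace_w_op])
  then have "w_op ?P \<subseteq> w_op I" using w_op_mono w_op_idem[OF I] by blast
  ultimately show ?thesis unfolding w_regular_def using C by blast
qed

theorem proposition3p1:
  assumes not_field: "\<exists>d::'a::idom. d \<noteq> 0 \<and> \<not> d dvd 1"
  shows "(clifford_w_regular_domain TYPE('a poly) \<longrightarrow> clifford_w_regular_domain TYPE('a)) \<and>
         (w_stable_domain TYPE('a poly) \<longrightarrow> w_stable_domain TYPE('a))"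
  unfolding clifford_w_regular_domain_def w_stable_domain_def
  using w_regular_of_poly_ext w_stable_poly_ext_iff poly_ext_nonzero_ideals by blast

end
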